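(* Let $H$ be a real Hilbert space and let $E:H\to\mathbb{R}$ be a functional with Nehari manifold $\mathcal{N}=\{u\in H\setminus\{0\}:\langle E'(u),u\rangle=0\}$. Assume: (A1) $E\in C^2(H,\mathbb{R})$, and for each $v\in H\setminus\{0\}$ the function $s\mapsto E(sv)$, $s\in(0,\infty)$, has a unique critical point $s_v>0$; (A2) $\langle E''(u)u,u\rangle<0$ for all $u\in\mathcal{N}$; (A3) there exists a constant $\sigma_0>0$ such that $\|u\|_H\ge\sigma_0$ for all $u\in\mathcal{N}$. For $v\in H\setminus\{0\}$ let $\rho(v)>0$ be the unique positive number with $\rho(v)v\in\mathcal{N}$. Then the mapping $$\mathcal{R}(u,v)=\rho(u+v)(u+v),\qquad (u,v)\in H\times H,\ u+v\ne0,$$ is a retraction on the Nehari manifold $\mathcal{N}$.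
   Context: $\langle\cdot,\cdot\rangle$ is the pairing between $H^*$ and $H$. Put $G(u)=\langle E'(u),u\rangle$ for $u\in H$. Under (A1)-(A3), $\mathcal{N}$ is a closed $C^1$ submanifold of $H$ with tangent space $T_u\mathcal{N}=\{\xi\in H:\langle G'(u),\xi\rangle=0\}$ and tangent bundle $T\mathcal{N}=\{(u,\xi):u\in\mathcal{N},\ \xi\in T_u\mathcal{N}\}$. Retraction on $\mathcal{N}$: a $C^1$ map $\mathcal{R}:T\mathcal{N}\to\mathcal{N}$ ($C^1$ meaning that it has a $C^1$ extension to an open subset of $H\times H$ containing $T\mathcal{N}$) such that, writing $\mathcal{R}_u=\mathcal{R}(u,\cdot)$ on $T_u\mathcal{N}$, for all $u\in\mathcal{N}$: (i) $\mathcal{R}_u(0)=u$; (ii) $\frac{d}{ds}\mathcal{R}_u(s\xi)|_{s=0}=\xi$ for all $\xi\in T_u\mathcal{N}$. A map given by a formula on a larger subset of $H\times H$ is called a retraction if it is defined on all of $T\mathcal{N}$ and its restriction to $T\mathcal{N}$ is a retraction. The existence and uniqueness of $\rho(v)$ for every $v\in H\setminus\{0\}$ follows from (A1), with $\rho(v)=s_v$. *)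

theory Defs
  imports "HOL-Analysis.Analysis"
begin

(* The Frechet derivative as a map into the space of bounded operators with the operator norm.
   It carries information only at points where f is differentiable; see fderiv_eqI. *)
definition fderiv ::
  "('a::real_normed_vector \<Rightarrow> 'b::real_normed_vector) \<Rightarrow> 'a \<Rightarrow> 'a \<Rightarrow>\<^sub>L 'b" where
  "fderiv f x = Blinfun (frechet_derivative f (at x))"

definition C1_on :: "'a::real_normed_vector set \<Rightarrow> ('a \<Rightarrow> 'b::real_normed_vector) \<Rightarrow> bool" where
  "C1_on U f \<longleftrightarrow> open U \<and> (\<forall>x\<in>U. f differentiable (at x)) \<and> continuous_on U (fderiv f)"

definition C2_on :: "'a::real_normed_vector set \<Rightarrow> ('a \<Rightarrow> 'b::real_normed_vector) \<Rightarrow> bool" where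
  "C2_on U f \<longleftrightarrow> C1_on U f \<and> C1_on U (fderiv f)"

(* The dual of H is the type of bounded operators from H to real, and the pairing of a functional
   with a vector is blinfun_apply. *)
definition nehari_fun :: "('a::real_normed_vector \<Rightarrow> real) \<Rightarrow> 'a \<Rightarrow> real" where
  "nehari_fun E u = blinfun_apply (fderiv E u) u"

definition nehari :: "('a::real_normed_vector \<Rightarrow> real) \<Rightarrow> 'a set" where
  "nehari E = {u. u \<noteq> 0 \<and> blinfun_apply (fderiv E u) u = 0}"

definition nehari_tangent :: "('a::real_normed_vector \<Rightarrow> real) \<Rightarrow> 'a \<Rightarrow> 'a set" where
  "nehari_tangent E u = {\<xi>. blinfun_apply (fderiv (nehari_fun E) u) \<xi> = 0}"

definition nehari_tangent_bundle ::
  "('a::real_normed_vector \<Rightarrow> real) \<Rightarrow> ('a \<times> 'a) set" where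
  "nehari_tangent_bundle E = {(u, \<xi>). u \<in> nehari E \<and> \<xi> \<in> nehari_tangent E u}"

(* R is regarded as a map with domain D; its values outside D are irrelevant. The C1 extension F
   takes values in the whole space, not necessarily in the Nehari manifold. *)
definition nehari_retraction ::
  "('a::real_normed_vector \<Rightarrow> real) \<Rightarrow> ('a \<times> 'a) set \<Rightarrow> ('a \<times> 'a \<Rightarrow> 'a) \<Rightarrow> bool" where
  "nehari_retraction E D R \<longleftrightarrow>
     nehari_tangent_bundle E \<subseteq> D \<and>
     R ` nehari_tangent_bundle E \<subseteq> nehari E \<and>
     (\<exists>U F. nehari_tangent_bundle E \<subseteq> U \<and> C1_on U F \<and>
        (\<forall>p\<in>nehari_tangent_bundle E. F p = R p)) \<and>
     (\<forall>u\<in>nehari E. R (u, 0) = u) \<and>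
     (\<forall>u\<in>nehari E. \<forall>\<xi>\<in>nehari_tangent E u.
        ((\<lambda>s. R (u, s *\<^sub>R \<xi>)) has_vector_derivative \<xi>) (at 0))"

(* Well defined for v \<noteq> 0 by nehari_scale_unique. *)
definition nehari_scale :: "('a::real_normed_vector \<Rightarrow> real) \<Rightarrow> 'a \<Rightarrow> real" where
  "nehari_scale E v = (THE t. 0 < t \<and> t *\<^sub>R v \<in> nehari E)"

lemma fderiv_has_derivative:
  assumes "f differentiable (at x)"
  shows "(f has_derivative blinfun_apply (fderiv f x)) (at x)"
proof -
  have d: "(f has_derivative frechet_derivative f (at x)) (at x)"
    using assms frechet_derivative_works by blast
  then have "bounded_linear (frechet_derivative f (at x))"
    by (rule has_derivative_bounded_linear)
  with d show ?thesis
    by (simp add: fderiv_def bounded_linear_Blinfun_apply)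
qed

lemma fderiv_eqI:
  assumes "(f has_derivative blinfun_apply A) (at x)"
  shows "fderiv f x = A"
  unfolding fderiv_def frechet_derivative_at[OF assms, symmetric]
  by (rule blinfun_apply_inverse)

lemma ray_critical_iff_nehari:
  assumes "E differentiable (at (s *\<^sub>R v))" "v \<noteq> 0" "0 < s"
  shows "((\<lambda>t. E (t *\<^sub>R v)) has_real_derivative 0) (at s) \<longleftrightarrow> s *\<^sub>R v \<in> nehari E"
proof -
  let ?d = "blinfun_apply (fderiv E (s *\<^sub>R v)) v"
  have g: "((\<lambda>t. t *\<^sub>R v) has_derivative (\<lambda>h. h *\<^sub>R v)) (at s)"
    by (auto intro!: derivative_eq_intros)
  have "((\<lambda>t. E (t *\<^sub>R v)) has_derivative (\<lambda>h. blinfun_apply (fderiv E (s *\<^sub>R v)) (h *\<^sub>R v))) (at s)"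
    by (rule has_derivative_compose[OF g fderiv_has_derivative[OF assms(1)]])
  then have "((\<lambda>t. E (t *\<^sub>R v)) has_real_derivative ?d) (at s)"
    by (simp add: has_field_derivative_def blinfun.scaleR_right mult_commute_abs)
  then have "((\<lambda>t. E (t *\<^sub>R v)) has_real_derivative 0) (at s) \<longleftrightarrow> ?d = 0"
    using DERIV_unique by metis
  also have "\<dots> \<longleftrightarrow> s *\<^sub>R v \<in> nehari E"
    using assms(2,3) by (simp add: nehari_def blinfun.scaleR_right)
  finally show ?thesis .
qed

lemma nehari_scale_unique:
  assumes "C2_on UNIV E" "v \<noteq> 0"
    and "\<exists>!s. 0 < s \<and> ((\<lambda>t. E (t *\<^sub>R v)) has_real_derivative 0) (at s)"
  shows "\<exists>!t. 0 < t \<and> t *\<^sub>R v \<in> nehari E"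
  using assms ray_critical_iff_nehari[of E _ v]
  by (simp add: C2_on_def C1_on_def cong: conj_cong)

end

theory Submission
  imports Defs
begin

text \<open>
  Write \<open>G(u) = \<langle>E'(u), u\<rangle>\<close> and let \<open>\<rho>(v)\<close> be the unique positive \<open>t\<close> with \<open>G(t v) = 0\<close>. The map
  \<open>(u, v) \<mapsto> \<rho>(u + v)(u + v)\<close> is the radial projection of \<open>u + v\<close> onto the Nehari manifold, and
  everything rests on one sign: on the manifold
  \<open>\<langle>G'(u), u\<rangle> = \<langle>E''(u)u, u\<rangle> + \<langle>E'(u), u\<rangle> = \<langle>E''(u)u, u\<rangle> < 0\<close>, so every ray crosses the
  manifold transversally (\<open>nehari_fun_radial_negative\<close>).

  Transversality has three consequences. It makes \<open>-u\<close> non-tangent at \<open>u\<close>, so \<open>u + \<xi>\<close> never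
  vanishes on the tangent bundle and the radial projection is defined there. It makes \<open>\<rho>\<close> a
  \<open>C\<^sup>1\<close> function on the punctured space (\<open>C1_on_ray_zero\<close>): the sign change of \<open>G\<close> along a ray
  persists on nearby rays, which together with uniqueness of the zero gives continuity, and then
  linearising \<open>G(\<rho>(v) v) = 0\<close> gives
  \<open>\<rho>'(v)h = - \<rho>(v) \<langle>G'(\<rho>(v) v), h\<rangle> / \<langle>G'(\<rho>(v) v), v\<rangle>\<close>. Finally this formula shows that
  \<open>\<rho>'(u)\<close> vanishes exactly on the tangent space when \<open>u\<close> lies on the manifold, where \<open>\<rho>(u) = 1\<close>.
  Hence the derivative \<open>\<rho>'(u)\<xi> u + \<rho>(u)\<xi>\<close> of \<open>w \<mapsto> \<rho>(w) w\<close> at \<open>u\<close> in a tangent direction \<open>\<xi>\<close>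
  is \<open>\<xi>\<close> itself.
\<close>

section \<open>Continuously differentiable maps\<close>

lemma C1_onI:
  assumes "open U"
    and "\<And>x. x \<in> U \<Longrightarrow> (f has_derivative blinfun_apply (D x)) (at x)"
    and "continuous_on U D"
  shows "C1_on U f"
proof -
  have "continuous_on U (fderiv f) \<longleftrightarrow> continuous_on U D"
    using assms(2) by (intro continuous_on_cong) (auto intro: fderiv_eqI)
  with assms show ?thesis
    unfolding C1_on_def differentiable_def by blast
qed

lemma C1_on_has_derivative:
  assumes "C1_on U f" "x \<in> U"
  shows "(f has_derivative blinfun_apply (fderiv f x)) (at x)"
  using assms by (auto simp: C1_on_def intro: fderiv_has_derivative)

lemma C1_on_continuous_fderiv: "C1_on U f \<Longrightarrow> continuous_on U (fderiv f)"
  by (simp add: C1_on_def)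

lemma C1_on_continuous_on:
  assumes "C1_on U f" shows "continuous_on U f"
  using C1_on_has_derivative[OF assms]
  by (meson continuous_at_imp_continuous_on has_derivative_continuous)

section \<open>The Nehari functional\<close>

lemma nehari_fun_has_derivative:
  assumes "C2_on UNIV E"
  shows "(nehari_fun E has_derivative
    blinfun_apply ((blinfun.prod_left u o\<^sub>L fderiv (fderiv E) u) + fderiv E u)) (at u)"
proof -
  have "(fderiv E has_derivative blinfun_apply (fderiv (fderiv E) u)) (at u)"
    using assms by (auto simp: C2_on_def intro: C1_on_has_derivative)
  from blinfun.FDERIV[OF this has_derivative_ident] show ?thesis
    unfolding nehari_fun_def[abs_def]
    by (rule has_derivative_eq_rhs) (auto simp: blinfun.bilinear_simps)
qed

lemma C1_on_nehari_fun:
  assumes "C2_on UNIV E"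
  shows "C1_on UNIV (nehari_fun E)"
proof (rule C1_onI)
  have "continuous_on UNIV (fderiv (fderiv E))" "continuous_on UNIV (fderiv E)"
    using assms by (auto simp: C2_on_def dest: C1_on_continuous_fderiv)
  then show "continuous_on UNIV (\<lambda>u. (blinfun.prod_left u o\<^sub>L fderiv (fderiv E) u) + fderiv E u)"
    by (intro continuous_intros)
qed (use nehari_fun_has_derivative[OF assms] in auto)

text \<open>On the manifold the first-order term \<open>\<langle>E'(u), u\<rangle>\<close> of \<open>\<langle>G'(u), u\<rangle>\<close> drops out.\<close>

lemma nehari_fun_radial_negative:
  assumes "C2_on UNIV E" "u \<in> nehari E"
    and "blinfun_apply (blinfun_apply (fderiv (fderiv E) u) u) u < 0"
  shows "blinfun_apply (fderiv (nehari_fun E) u) u < 0"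
  using assms(2,3) fderiv_eqI[OF nehari_fun_has_derivative[OF assms(1)], of u]
  by (simp add: nehari_def blinfun.bilinear_simps)

section \<open>The zero along a ray as a function of its direction\<close>

text \<open>
  Only differentiability at the one point \<open>(\<rho> v, v)\<close> is asked of \<open>g\<close>, since continuity of the
  implicit function is given. First, the linearisation bounds the increment of \<open>\<rho>\<close> by a
  multiple of that of \<open>v\<close>; this turns the remainder, which is small compared with both
  increments, into one that is small compared with the increment of \<open>v\<close> alone.
\<close>

lemma has_derivative_implicit_scalar:
  fixes g :: "real \<times> 'a::real_normed_vector \<Rightarrow> real" and \<rho> :: "'a \<Rightarrow> real"
  assumes der: "(g has_derivative (\<lambda>(s, h). a * s + B h)) (at (\<rho> v, v))"
    and a: "a \<noteq> 0"
    and B: "bounded_linear B"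
    and cont: "isCont \<rho> v"
    and zero: "\<forall>\<^sub>F w in nhds v. g (\<rho> w, w) = 0"
  shows "(\<rho> has_derivative (\<lambda>h. - B h / a)) (at v)"
proof -
  obtain K where K: "0 < K" "\<And>h. norm (B h) \<le> norm h * K"
    using bounded_linear.pos_bounded[OF B] by blast
  have zero_v: "g (\<rho> v, v) = 0"
    using zero by (rule eventually_nhds_x_imp_x)
  have lin: "\<forall>\<^sub>F w in nhds v. \<bar>a * (\<rho> w - \<rho> v) + B (w - v)\<bar> \<le> e * (\<bar>\<rho> w - \<rho> v\<bar> + norm (w - v))"
    if "0 < e" for e
  proof -
    obtain d where d: "0 < d" "\<And>p. norm (p - (\<rho> v, v)) < d \<Longrightarrow>
        norm (g p - g (\<rho> v, v) - (case p - (\<rho> v, v) of (s, h) \<Rightarrow> a * s + B h))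
          \<le> e * norm (p - (\<rho> v, v))"
      using der \<open>0 < e\<close> unfolding has_derivative_at_alt by blast
    have "((\<lambda>w. (\<rho> w, w)) \<longlongrightarrow> (\<rho> v, v)) (nhds v)"
      using cont by (auto intro!: tendsto_Pair filterlim_ident simp: isCont_def tendsto_at_iff_tendsto_nhds)
    then have "\<forall>\<^sub>F w in nhds v. dist (\<rho> w, w) (\<rho> v, v) < d"
      using d(1) by (rule tendstoD)
    with zero show ?thesis
    proof eventually_elim
      case (elim w)
      then have "\<bar>a * (\<rho> w - \<rho> v) + B (w - v)\<bar> \<le> e * norm (\<rho> w - \<rho> v, w - v)"
        using d(2)[of "(\<rho> w, w)"] zero_v by (simp add: dist_norm)
      also have "\<dots> \<le> e * (\<bar>\<rho> w - \<rho> v\<bar> + norm (w - v))"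
        using norm_Pair_le[of "\<rho> w - \<rho> v" "w - v"] \<open>0 < e\<close> by (simp add: mult_left_mono)
      finally show ?case .
    qed
  qed
  define L where "L = 2 * K / \<bar>a\<bar> + 1"
  have L: "0 < L" using K(1) a by (simp add: L_def add_nonneg_pos)
  \<comment> \<open>The remainder is allowed to use up half of the factor \<open>\<bar>a\<bar>\<close> in front of the increment of \<open>\<rho>\<close>.\<close>
  have lip: "\<forall>\<^sub>F w in nhds v. \<bar>\<rho> w - \<rho> v\<bar> \<le> L * norm (w - v)"
  proof -
    have "0 < \<bar>a\<bar> / 2" using a by simp
    from lin[OF this] show ?thesis
    proof eventually_elim
      case (elim w)
      have "\<bar>a\<bar> * \<bar>\<rho> w - \<rho> v\<bar> \<le> \<bar>a * (\<rho> w - \<rho> v) + B (w - v)\<bar> + \<bar>B (w - v)\<bar>"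
        by (simp add: abs_mult[symmetric])
      also have "\<dots> \<le> \<bar>a\<bar> / 2 * (\<bar>\<rho> w - \<rho> v\<bar> + norm (w - v)) + norm (w - v) * K"
        using elim K(2)[of "w - v"] by simp
      finally have "\<bar>a\<bar> * \<bar>\<rho> w - \<rho> v\<bar> \<le> \<bar>a\<bar> * norm (w - v) + 2 * K * norm (w - v)"
        by (simp add: algebra_simps)
      also have "\<dots> = \<bar>a\<bar> * (L * norm (w - v))"
        using a by (simp add: L_def field_simps)
      finally show ?case using a by simp
    qed
  qed
  show ?thesis
    unfolding has_derivative_within_alt2
  proof (intro conjI allI impI)
    show "bounded_linear (\<lambda>h. - B h / a)"
      using bounded_linear_compose[OF bounded_linear_mult_right B, of "- 1 / a"] by simp
    fix e :: real assume "0 < e"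
    define e' where "e' = e * \<bar>a\<bar> / (L + 1)"
    have e': "0 < e'" using \<open>0 < e\<close> a L by (simp add: e'_def)
    have "\<forall>\<^sub>F w in nhds v. norm (\<rho> w - \<rho> v - - B (w - v) / a) \<le> e * norm (w - v)"
      using lin[OF e'] lip
    proof eventually_elim
      case (elim w)
      have "\<bar>a\<bar> * \<bar>\<rho> w - \<rho> v - - B (w - v) / a\<bar> = \<bar>a * (\<rho> w - \<rho> v) + B (w - v)\<bar>"
        using a by (simp add: abs_mult[symmetric] field_simps)
      also have "\<dots> \<le> e' * (L * norm (w - v) + norm (w - v))"
        using elim e' by (meson add_right_mono less_imp_le mult_left_mono order_trans)
      also have "\<dots> = e' * (L + 1) * norm (w - v)"
        by (simp add: algebra_simps)
      also have "\<dots> = \<bar>a\<bar> * (e * norm (w - v))"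
        using L by (simp add: e'_def)
      finally show ?case using a by simp
    qed
    then show "\<forall>\<^sub>F w in at v. norm (\<rho> w - \<rho> v - - B (w - v) / a) \<le> e * norm (w - v)"
      by (simp add: eventually_at_filter eventually_mono)
  qed
qed

text \<open>
  Along the ray through \<open>v\<close> the function \<open>G\<close> changes sign from positive to negative at
  \<open>\<rho> v\<close>. The signs at \<open>\<rho> v - \<epsilon>\<close> and \<open>\<rho> v + \<epsilon>\<close> persist on nearby rays, so by the
  intermediate value theorem each of these has a zero between the two parameters, and by
  uniqueness that zero is \<open>\<rho>\<close>.
\<close>

lemma isCont_ray_zero:
  fixes G :: "'a::real_normed_vector \<Rightarrow> real" and \<rho> :: "'a \<Rightarrow> real"
  assumes C1: "C1_on UNIV G"
    and unique: "\<And>w t. w \<noteq> 0 \<Longrightarrow> 0 < t \<Longrightarrow> G (t *\<^sub>R w) = 0 \<Longrightarrow> t = \<rho> w"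
    and pos: "0 < \<rho> v"
    and zero: "G (\<rho> v *\<^sub>R v) = 0"
    and neg: "blinfun_apply (fderiv G (\<rho> v *\<^sub>R v)) v < 0"
    and v: "v \<noteq> 0"
  shows "isCont \<rho> v"
proof -
  have contG: "continuous_on UNIV G" using C1 by (rule C1_on_continuous_on)
  have "((\<lambda>t. t *\<^sub>R v) has_derivative (\<lambda>h. h *\<^sub>R v)) (at (\<rho> v))"
    by (auto intro!: derivative_eq_intros)
  from has_derivative_compose[OF this C1_on_has_derivative[OF C1]]
  have der: "((\<lambda>t. G (t *\<^sub>R v)) has_real_derivative blinfun_apply (fderiv G (\<rho> v *\<^sub>R v)) v) (at (\<rho> v))"
    by (simp add: has_field_derivative_def blinfun.scaleR_right mult_commute_abs)
  obtain d1 where d1: "0 < d1" "\<And>h. 0 < h \<Longrightarrow> h < d1 \<Longrightarrow> 0 < G ((\<rho> v - h) *\<^sub>R v)"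
    using DERIV_neg_dec_left[OF der neg] zero by auto
  obtain d2 where d2: "0 < d2" "\<And>h. 0 < h \<Longrightarrow> h < d2 \<Longrightarrow> G ((\<rho> v + h) *\<^sub>R v) < 0"
    using DERIV_neg_dec_right[OF der neg] zero by auto
  have "continuous_on UNIV (\<lambda>w. G (t *\<^sub>R w))" for t
    by (intro continuous_on_compose2[OF contG] continuous_intros) auto
  then have ray_tendsto: "((\<lambda>w. G (t *\<^sub>R w)) \<longlongrightarrow> G (t *\<^sub>R v)) (at v)" for t
    by (simp add: continuous_on_def)
  have "(\<rho> \<longlongrightarrow> \<rho> v) (at v)"
  proof (rule tendstoI)
    fix e :: real assume "0 < e"
    define h where "h = min (min d1 d2) (min e (\<rho> v)) / 2"
    have h: "0 < h" "h < d1" "h < d2" "h < e" "h < \<rho> v"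
      using d1(1) d2(1) \<open>0 < e\<close> pos by (auto simp: h_def min_def)
    have "\<forall>\<^sub>F w in at v. 0 < G ((\<rho> v - h) *\<^sub>R w)"
      using ray_tendsto d1(2)[OF h(1,2)] by (rule order_tendstoD)
    moreover have "\<forall>\<^sub>F w in at v. G ((\<rho> v + h) *\<^sub>R w) < 0"
      using ray_tendsto d2(2)[OF h(1,3)] by (rule order_tendstoD)
    moreover have "\<forall>\<^sub>F w in at v. w \<noteq> 0"
      using v by (intro tendsto_imp_eventually_ne[OF tendsto_ident_at])
    ultimately show "\<forall>\<^sub>F w in at v. dist (\<rho> w) (\<rho> v) < e"
    proof eventually_elim
      case (elim w)
      have "continuous_on {\<rho> v - h .. \<rho> v + h} (\<lambda>t. G (t *\<^sub>R w))"
        by (intro continuous_on_compose2[OF contG] continuous_intros) auto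
      then obtain t where t: "\<rho> v - h \<le> t" "t \<le> \<rho> v + h" "G (t *\<^sub>R w) = 0"
        using IVT2'[of "\<lambda>t. G (t *\<^sub>R w)" "\<rho> v + h" 0 "\<rho> v - h"] elim h(1) by auto
      moreover have "t = \<rho> w"
        using unique elim(3) t h(5) by auto
      ultimately show ?case
        using h(4) by (simp add: dist_real_def abs_less_iff)
    qed
  qed
  then show ?thesis by (simp add: isCont_def)
qed

lemma ray_zero_has_derivative:
  fixes G :: "'a::real_normed_vector \<Rightarrow> real" and \<rho> :: "'a \<Rightarrow> real"
  assumes C1: "C1_on UNIV G"
    and unique: "\<And>w t. w \<noteq> 0 \<Longrightarrow> 0 < t \<Longrightarrow> G (t *\<^sub>R w) = 0 \<Longrightarrow> t = \<rho> w"
    and pos: "\<And>w. w \<noteq> 0 \<Longrightarrow> 0 < \<rho> w"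
    and zero: "\<And>w. w \<noteq> 0 \<Longrightarrow> G (\<rho> w *\<^sub>R w) = 0"
    and neg: "\<And>w. w \<noteq> 0 \<Longrightarrow> blinfun_apply (fderiv G (\<rho> w *\<^sub>R w)) w < 0"
    and v: "v \<noteq> 0"
  shows "(\<rho> has_derivative blinfun_apply
    (- (\<rho> v / blinfun_apply (fderiv G (\<rho> v *\<^sub>R v)) v) *\<^sub>R fderiv G (\<rho> v *\<^sub>R v))) (at v)"
proof -
  let ?A = "fderiv G (\<rho> v *\<^sub>R v)"
  have "((\<lambda>p. fst p *\<^sub>R snd p) has_derivative (\<lambda>p. \<rho> v *\<^sub>R snd p + fst p *\<^sub>R v)) (at (\<rho> v, v))"
    by (auto intro!: derivative_eq_intros)
  from has_derivative_compose[OF this C1_on_has_derivative[OF C1]]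
  have "((\<lambda>p. G (fst p *\<^sub>R snd p)) has_derivative (\<lambda>(s, h). ?A v * s + \<rho> v * ?A h)) (at (\<rho> v, v))"
    by (simp add: blinfun.bilinear_simps case_prod_beta' algebra_simps)
  moreover have "isCont \<rho> v"
    by (rule isCont_ray_zero[where G = G and \<rho> = \<rho>, OF C1 _ pos[OF v] zero[OF v] neg[OF v] v]) (rule unique)
  moreover have "\<forall>\<^sub>F w in nhds v. w \<noteq> 0"
    using v by (intro t1_space_nhds)
  then have "\<forall>\<^sub>F w in nhds v. G (fst (\<rho> w, w) *\<^sub>R snd (\<rho> w, w)) = 0"
    by eventually_elim (simp add: zero)
  moreover have "bounded_linear (\<lambda>h. \<rho> v * ?A h)"
    by (intro bounded_linear_const_mult blinfun.bounded_linear_right)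
  ultimately have "(\<rho> has_derivative (\<lambda>h. - (\<rho> v * ?A h) / ?A v)) (at v)"
    using neg[OF v] by (intro has_derivative_implicit_scalar[where g = "\<lambda>p. G (fst p *\<^sub>R snd p)"]) auto
  then show ?thesis
    by (rule has_derivative_eq_rhs) (simp add: blinfun.bilinear_simps fun_eq_iff)
qed

lemma C1_on_ray_zero:
  fixes G :: "'a::real_normed_vector \<Rightarrow> real" and \<rho> :: "'a \<Rightarrow> real"
  assumes C1: "C1_on UNIV G"
    and unique: "\<And>w t. w \<noteq> 0 \<Longrightarrow> 0 < t \<Longrightarrow> G (t *\<^sub>R w) = 0 \<Longrightarrow> t = \<rho> w"
    and pos: "\<And>w. w \<noteq> 0 \<Longrightarrow> 0 < \<rho> w"
    and zero: "\<And>w. w \<noteq> 0 \<Longrightarrow> G (\<rho> w *\<^sub>R w) = 0"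
    and neg: "\<And>w. w \<noteq> 0 \<Longrightarrow> blinfun_apply (fderiv G (\<rho> w *\<^sub>R w)) w < 0"
  shows "C1_on (- {0}) \<rho>"
proof (rule C1_onI)
  show "(\<rho> has_derivative blinfun_apply
    (- (\<rho> v / blinfun_apply (fderiv G (\<rho> v *\<^sub>R v)) v) *\<^sub>R fderiv G (\<rho> v *\<^sub>R v))) (at v)"
    if "v \<in> - {0}" for v
    using ray_zero_has_derivative[OF C1 unique pos zero neg] that by blast
  have "isCont \<rho> v" if "v \<noteq> 0" for v
    by (rule isCont_ray_zero[where G = G and \<rho> = \<rho>, OF C1 _ pos[OF that] zero[OF that] neg[OF that] that]) (rule unique)
  then have "continuous_on (- {0}) \<rho>"
    by (intro continuous_at_imp_continuous_on) blast
  moreover from this have "continuous_on (- {0}) (\<lambda>v. fderiv G (\<rho> v *\<^sub>R v))"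
    by (intro continuous_on_compose2[OF C1_on_continuous_fderiv[OF C1]] continuous_intros) auto
  ultimately show "continuous_on (- {0})
      (\<lambda>v. - (\<rho> v / blinfun_apply (fderiv G (\<rho> v *\<^sub>R v)) v) *\<^sub>R fderiv G (\<rho> v *\<^sub>R v))"
    by (intro continuous_intros) (auto dest: neg)
qed auto

section \<open>The radial projection\<close>

lemma radial_map_has_derivative:
  assumes "C1_on (- {0}) \<rho>" "w \<noteq> 0"
  shows "((\<lambda>w. \<rho> w *\<^sub>R w) has_derivative
    blinfun_apply ((blinfun_scaleR_left w o\<^sub>L fderiv \<rho> w) + blinfun_scaleR_right (\<rho> w))) (at w)"
proof -
  have "(\<rho> has_derivative blinfun_apply (fderiv \<rho> w)) (at w)"
    using assms by (auto intro: C1_on_has_derivative)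
  from has_derivative_scaleR[OF this has_derivative_ident] show ?thesis
    by (rule has_derivative_eq_rhs) (auto simp: blinfun.bilinear_simps)
qed

lemma C1_on_radial_map_sum:
  fixes \<rho> :: "'a::real_normed_vector \<Rightarrow> real"
  assumes C1: "C1_on (- {0}) \<rho>"
  shows "C1_on {(u, v). u + v \<noteq> 0} (\<lambda>(u, v). \<rho> (u + v) *\<^sub>R (u + v))"
proof -
  let ?U = "{p :: 'a \<times> 'a. fst p + snd p \<noteq> 0}"
  let ?P = "\<lambda>w. (blinfun_scaleR_left w o\<^sub>L fderiv \<rho> w) + blinfun_scaleR_right (\<rho> w)"
  let ?D = "\<lambda>p :: 'a \<times> 'a. ?P (fst p + snd p) o\<^sub>L (fst_blinfun + snd_blinfun)"
  have "C1_on ?U (\<lambda>p. \<rho> (fst p + snd p) *\<^sub>R (fst p + snd p))"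
  proof (rule C1_onI[where D = ?D])
    show "open ?U"
      by (intro open_Collect_neq continuous_intros)
    show "((\<lambda>p. \<rho> (fst p + snd p) *\<^sub>R (fst p + snd p)) has_derivative blinfun_apply (?D p)) (at p)"
      if "p \<in> ?U" for p
    proof -
      have "((\<lambda>p. fst p + snd p) has_derivative (\<lambda>q. fst q + snd q)) (at p)"
        by (auto intro!: derivative_eq_intros)
      from has_derivative_compose[OF this radial_map_has_derivative[OF C1]] that
      show ?thesis by (auto simp: plus_blinfun.rep_eq o_def blinfun_compose.rep_eq)
    qed
    have "continuous_on (- {0}) ?P"
      using C1_on_continuous_on[OF C1] C1_on_continuous_fderiv[OF C1] by (intro continuous_intros)
    then have "continuous_on ?U (\<lambda>p. ?P (fst p + snd p))"
      by (rule continuous_on_compose2) (auto intro!: continuous_intros)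
    then show "continuous_on ?U ?D"
      by (rule bounded_bilinear.continuous_on[OF bounded_bilinear_blinfun_compose _ continuous_on_const])
  qed
  then show ?thesis by (simp add: case_prod_beta')
qed

section \<open>The retraction\<close>

theorem lemma3p5:
  fixes E :: "'h::{real_inner, complete_space} \<Rightarrow> real"
  assumes A1_C2: "C2_on UNIV E"
    and A1_crit: "\<And>v. v \<noteq> 0 \<Longrightarrow>
      \<exists>!s. 0 < s \<and> ((\<lambda>t. E (t *\<^sub>R v)) has_real_derivative 0) (at s)"
    and A2: "\<And>u. u \<in> nehari E \<Longrightarrow>
      blinfun_apply (blinfun_apply (fderiv (fderiv E) u) u) u < 0"
    and A3: "\<exists>\<sigma>\<^sub>0>0. \<forall>u\<in>nehari E. \<sigma>\<^sub>0 \<le> norm u"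
  shows "nehari_retraction E {(u, v). u + v \<noteq> 0}
    (\<lambda>(u, v). nehari_scale E (u + v) *\<^sub>R (u + v))"
proof -
  let ?G = "nehari_fun E" and ?\<rho> = "nehari_scale E"
  let ?R = "\<lambda>(u, v). ?\<rho> (u + v) *\<^sub>R (u + v)"
  have nehari_iff: "u \<in> nehari E \<longleftrightarrow> u \<noteq> 0 \<and> ?G u = 0" for u
    by (simp add: nehari_def nehari_fun_def)
  have ex1: "\<exists>!t. 0 < t \<and> t *\<^sub>R v \<in> nehari E" if "v \<noteq> 0" for v
    using nehari_scale_unique[OF A1_C2 that A1_crit[OF that]] .
  have scale: "0 < ?\<rho> v" "?\<rho> v *\<^sub>R v \<in> nehari E" if "v \<noteq> 0" for v
    using theI'[OF ex1[OF that]] by (simp_all add: nehari_scale_def)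
  have scale_eq: "t = ?\<rho> v" if "v \<noteq> 0" "0 < t" "t *\<^sub>R v \<in> nehari E" for v t
    using ex1[OF that(1)] scale[OF that(1)] that by blast
  have radial_neg: "blinfun_apply (fderiv ?G u) u < 0" if "u \<in> nehari E" for u
    using nehari_fun_radial_negative[OF A1_C2 that A2[OF that]] .
  have C1_G: "C1_on UNIV ?G"
    by (rule C1_on_nehari_fun[OF A1_C2])
  have unique: "t = ?\<rho> v" if "v \<noteq> 0" "0 < t" "?G (t *\<^sub>R v) = 0" for v t
    using scale_eq that by (simp add: nehari_iff)
  have zero: "?G (?\<rho> v *\<^sub>R v) = 0" if "v \<noteq> 0" for v
    using scale(2)[OF that] by (simp add: nehari_iff)
  have neg: "blinfun_apply (fderiv ?G (?\<rho> v *\<^sub>R v)) v < 0" if "v \<noteq> 0" for v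
    using radial_neg[OF scale(2)[OF that]] scale(1)[OF that]
    by (simp add: blinfun.scaleR_right mult_less_0_iff)
  have C1_scale: "C1_on (- {0}) ?\<rho>"
    using C1_on_ray_zero[OF C1_G unique scale(1) zero neg] by blast
  have scale_one: "?\<rho> u = 1" if "u \<in> nehari E" for u
    using scale_eq[of u 1] that by (simp add: nehari_iff)
  have sum_nonzero: "u + \<xi> \<noteq> 0" if "u \<in> nehari E" "\<xi> \<in> nehari_tangent E u" for u \<xi>
  proof
    assume "u + \<xi> = 0"
    then have "\<xi> = - u" by (simp add: eq_neg_iff_add_eq_0 add.commute)
    with that radial_neg[OF that(1)] show False
      by (simp add: nehari_tangent_def blinfun.minus_right)
  qed
  then have bundle_sum: "nehari_tangent_bundle E \<subseteq> {(u, v). u + v \<noteq> 0}"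
    by (auto simp: nehari_tangent_bundle_def)
  have tangent: "((\<lambda>s. ?R (u, s *\<^sub>R \<xi>)) has_vector_derivative \<xi>) (at 0)"
    if u: "u \<in> nehari E" and tang: "\<xi> \<in> nehari_tangent E u" for u \<xi>
  proof -
    have "u \<noteq> 0" using u by (simp add: nehari_iff)
    have "fderiv ?\<rho> u = - (?\<rho> u / blinfun_apply (fderiv ?G (?\<rho> u *\<^sub>R u)) u) *\<^sub>R fderiv ?G (?\<rho> u *\<^sub>R u)"
      using fderiv_eqI[OF ray_zero_has_derivative[OF C1_G unique scale(1) zero neg \<open>u \<noteq> 0\<close>]] .
    then have scale_deriv_zero: "blinfun_apply (fderiv ?\<rho> u) \<xi> = 0"
      using tang scale_one[OF u] by (simp add: nehari_tangent_def blinfun.bilinear_simps)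
    have "((\<lambda>s. u + s *\<^sub>R \<xi>) has_derivative (\<lambda>s. s *\<^sub>R \<xi>)) (at 0)"
      by (auto intro!: derivative_eq_intros)
    then have "((\<lambda>s. ?\<rho> (u + s *\<^sub>R \<xi>) *\<^sub>R (u + s *\<^sub>R \<xi>)) has_derivative
        (\<lambda>s. blinfun_apply ((blinfun_scaleR_left u o\<^sub>L fderiv ?\<rho> u) + blinfun_scaleR_right (?\<rho> u))
          (s *\<^sub>R \<xi>))) (at 0)"
      by (rule has_derivative_compose) (simp add: radial_map_has_derivative[OF C1_scale \<open>u \<noteq> 0\<close>])
    then show ?thesis
      by (simp add: has_vector_derivative_def blinfun.bilinear_simps scale_deriv_zero scale_one[OF u])
  qed
  show ?thesis
    unfolding nehari_retraction_def
  proof (intro conjI ballI)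
    show "?R ` nehari_tangent_bundle E \<subseteq> nehari E"
      using bundle_sum scale(2) by fastforce
    show "\<exists>U F. nehari_tangent_bundle E \<subseteq> U \<and> C1_on U F \<and>
        (\<forall>p\<in>nehari_tangent_bundle E. F p = ?R p)"
      using bundle_sum C1_on_radial_map_sum[OF C1_scale] by blast
    show "?R (u, 0) = u" if "u \<in> nehari E" for u
      using scale_one[OF that] by simp
  qed (use bundle_sum tangent in auto)
qed

end
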